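(* For every positive integer $n$, $$t(1,1,1,6;n)=\frac 16\big(N(1,1,1,6;32n+36)-N(1,1,1,6;8n+9)\big).$$
   Context: For positive integers $a_1,\dots,a_k$ and a nonnegative integer $n$, $N(a_1,\dots,a_k;n)$ is the number of $(x_1,\dots,x_k)\in\mathbb Z^k$ with $n=a_1x_1^2+\cdots+a_kx_k^2$, and $t(a_1,\dots,a_k;n)$ is the number of $(x_1,\dots,x_k)\in\mathbb Z^k$ with $n=a_1\frac{x_1(x_1-1)}2+\cdots+a_k\frac{x_k(x_k-1)}2$. *)

theory Defs
  imports Complex_Main
begin

definition N :: "nat list \<Rightarrow> nat \<Rightarrow> nat" where
  "N as n = card {xs :: int list. length xs = length as \<and>
     int n = (\<Sum>i<length as. int (as ! i) * (xs ! i)\<^sup>2)}"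

(* The division by 2 is exact, since x * (x - 1) is always even. *)
definition t :: "nat list \<Rightarrow> nat \<Rightarrow> nat" where
  "t as n = card {xs :: int list. length xs = length as \<and>
     int n = (\<Sum>i<length as. int (as ! i) * (xs ! i * (xs ! i - 1) div 2))}"

end

theory Submission
  imports Defs
begin

text \<open>
  Put \<open>m = 8n + 9\<close>. Completing squares, \<open>t(1,1,1,6;n)\<close> counts the representations of \<open>m\<close> by
  \<open>x\<^sup>2 + y\<^sup>2 + z\<^sup>2 + 6w\<^sup>2\<close> with all variables odd. Modulo 4, a representation of \<open>4m\<close> either has all
  variables even, which gives \<open>N(1,1,1,6;m)\<close>, or \<open>w\<close> and exactly two of \<open>x, y, z\<close> are odd. When \<open>z\<close>
  is the even one, put \<open>x = 2u + v\<close>, \<open>y = 2u - v\<close> (up to the sign of \<open>y\<close>), so that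
  \<open>8u\<^sup>2 + 2(v\<^sup>2 + 3w\<^sup>2) + z\<^sup>2 = 4m\<close> with \<open>v, w\<close> odd. Up to the sign of \<open>v\<close> one has
  \<open>v = b + 3c\<close> and \<open>w = b - c\<close>, and \<open>v\<^sup>2 + 3w\<^sup>2 = 4(b\<^sup>2 + 3c\<^sup>2)\<close> (multiplication by an Eisenstein
  integer of norm 4). Then \<open>(u + b, u - b, z / 2, c)\<close> is an all-odd representation
  of \<open>m\<close>. Counting the signs gives \<open>2 t(1,1,1,6;n)\<close> for each position of the even variable.
\<close>

definition reps :: "int \<Rightarrow> (int \<times> int \<times> int \<times> int) set" where
  "reps k = {(x, y, z, w). x\<^sup>2 + y\<^sup>2 + z\<^sup>2 + 6 * w\<^sup>2 = k}"

definition odd_reps :: "int \<Rightarrow> (int \<times> int \<times> int \<times> int) set" where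
  "odd_reps k = {(x, y, z, w) \<in> reps k. odd x \<and> odd y \<and> odd z \<and> odd w}"

definition mixed_reps :: "int \<Rightarrow> (int \<times> int \<times> int \<times> int) set" where
  "mixed_reps k = {(x, y, z, w) \<in> reps k. odd x \<and> odd y \<and> even z \<and> odd w}"

text \<open>The common target of both counts: the all-odd representations
  \<open>(x, y, z, w)\<close> with \<open>4 dvd x - y\<close>, in the coordinates
  \<open>x = u + b\<close>, \<open>y = u - b\<close>.\<close>

definition diag_reps :: "int \<Rightarrow> (int \<times> int \<times> int \<times> int) set" where
  "diag_reps k = {(u, b, z, c). 2 * u\<^sup>2 + 2 * b\<^sup>2 + z\<^sup>2 + 6 * c\<^sup>2 = k \<and>
     odd u \<and> even b \<and> odd z \<and> odd c}"

section \<open>Finiteness, and solutions as quadruples\<close>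

lemma abs_le_power2_int: "\<bar>x\<bar> \<le> x\<^sup>2" for x :: int
proof (cases "x = 0")
  case False
  then have "\<bar>x\<bar> * 1 \<le> \<bar>x\<bar> * \<bar>x\<bar>" by (intro mult_left_mono) auto
  then show ?thesis by (simp add: power2_eq_square)
qed simp

lemma finite_reps: "finite (reps k)"
proof (rule finite_subset)
  show "reps k \<subseteq> {-k..k} \<times> {-k..k} \<times> {-k..k} \<times> {-k..k}"
  proof
    fix p assume "p \<in> reps k"
    then obtain x y z w where p: "p = (x, y, z, w)" and k: "x\<^sup>2 + y\<^sup>2 + z\<^sup>2 + 6 * w\<^sup>2 = k"
      by (auto simp: reps_def)
    have "x\<^sup>2 \<ge> 0" "y\<^sup>2 \<ge> 0" "z\<^sup>2 \<ge> 0" "w\<^sup>2 \<ge> 0" by simp_all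
    then have "\<bar>x\<bar> \<le> k" "\<bar>y\<bar> \<le> k" "\<bar>z\<bar> \<le> k" "\<bar>w\<bar> \<le> k"
      using k abs_le_power2_int[of x] abs_le_power2_int[of y] abs_le_power2_int[of z]
        abs_le_power2_int[of w] by linarith+
    then show "p \<in> {-k..k} \<times> {-k..k} \<times> {-k..k} \<times> {-k..k}" by (auto simp: p)
  qed
qed auto

lemma card_lists_eq_card_tuples:
  "card {xs :: 'a list. length xs = 4 \<and> P (xs ! 0) (xs ! 1) (xs ! 2) (xs ! 3)} =
   card {(x, y, z, w). P x y z w}"
proof (rule bij_betw_same_card[symmetric], rule bij_betw_byWitness)
  show "\<forall>xs \<in> {xs :: 'a list. length xs = 4 \<and> P (xs ! 0) (xs ! 1) (xs ! 2) (xs ! 3)}.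
      (\<lambda>(x, y, z, w). [x, y, z, w]) ((\<lambda>xs. (xs ! 0, xs ! 1, xs ! 2, xs ! 3)) xs) = xs"
    by (auto simp: list_eq_iff_nth_eq less_Suc_eq numeral_eq_Suc)
qed auto

lemma N_eq_card_reps: "N [1, 1, 1, 6] k = card (reps (int k))"
proof -
  have "N [1, 1, 1, 6] k = card {xs :: int list. length xs = 4 \<and>
      (xs ! 0)\<^sup>2 + (xs ! 1)\<^sup>2 + (xs ! 2)\<^sup>2 + 6 * (xs ! 3)\<^sup>2 = int k}"
    unfolding N_def by (intro arg_cong[where f = card]) (auto simp: numeral_eq_Suc)
  also have "\<dots> = card (reps (int k))"
    unfolding reps_def
    by (rule card_lists_eq_card_tuples[where P = "\<lambda>x y z w. x\<^sup>2 + y\<^sup>2 + z\<^sup>2 + 6 * w\<^sup>2 = int k"])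
  finally show ?thesis .
qed

section \<open>Triangular numbers, odd squares and halving by involutions\<close>

lemma power2_odd_triangular: "(2 * x - 1)\<^sup>2 = 8 * (x * (x - 1) div 2) + 1" for x :: int
proof -
  have "even (x * (x - 1))" by simp
  then have "2 * (x * (x - 1) div 2) = x * (x - 1)" by (rule dvd_mult_div_cancel)
  moreover have "(2 * x - 1)\<^sup>2 = 4 * (x * (x - 1)) + 1"
    by (simp add: power2_eq_square algebra_simps)
  ultimately show ?thesis by linarith
qed

text \<open>The map \<open>x\<close> to \<open>2 * x - 1\<close> sends the integers bijectively onto
  the odd integers. Multiplying the equation by 8 completes each square at the cost of its
  coefficient, and 1 + 1 + 1 + 6 = 9.\<close>

lemma t_eq_card_odd_reps: "t [1, 1, 1, 6] n = card (odd_reps (8 * int n + 9))"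
proof -
  let ?T = "\<lambda>x :: int. x * (x - 1) div 2"
  let ?S = "{(x, y, z, w). ?T x + ?T y + ?T z + 6 * ?T w = int n}"
  have "t [1, 1, 1, 6] n = card {xs :: int list. length xs = 4 \<and>
      ?T (xs ! 0) + ?T (xs ! 1) + ?T (xs ! 2) + 6 * ?T (xs ! 3) = int n}"
    unfolding t_def by (intro arg_cong[where f = card]) (auto simp: numeral_eq_Suc)
  also have "\<dots> = card ?S"
    by (rule card_lists_eq_card_tuples)
  also
  let ?f = "\<lambda>(x, y, z, w). (2 * x - 1, 2 * y - 1, 2 * z - 1, 2 * w - 1 :: int)"
  let ?g = "\<lambda>(x, y, z, w). ((x + 1) div 2, (y + 1) div 2, (z + 1) div 2, (w + 1) div 2 :: int)"
  have "\<dots> = card (odd_reps (8 * int n + 9))"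
  proof (rule bij_betw_same_card, rule bij_betw_byWitness[where f = ?f and f' = ?g])
    show "\<forall>p \<in> ?S. ?g (?f p) = p" by auto
    show "\<forall>p \<in> odd_reps (8 * int n + 9). ?f (?g p) = p"
      by (auto simp: odd_reps_def) presburger+
    show "?f ` ?S \<subseteq> odd_reps (8 * int n + 9)"
      by (auto simp: odd_reps_def reps_def power2_odd_triangular)
    show "?g ` odd_reps (8 * int n + 9) \<subseteq> ?S"
    proof clarify
      fix x y z w assume p: "(x, y, z, w) \<in> odd_reps (8 * int n + 9)"
      define a b c d where ab: "a = (x + 1) div 2" "b = (y + 1) div 2"
        and cd: "c = (z + 1) div 2" "d = (w + 1) div 2"
      have "x = 2 * a - 1" "y = 2 * b - 1" "z = 2 * c - 1" "w = 2 * d - 1"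
        using p unfolding odd_reps_def ab cd by auto presburger+
      then have "?T a + ?T b + ?T c + 6 * ?T d = int n"
        using p by (simp add: odd_reps_def reps_def power2_odd_triangular)
      then show "?T ((x + 1) div 2) + ?T ((y + 1) div 2) + ?T ((z + 1) div 2)
          + 6 * ?T ((w + 1) div 2) = int n"
        unfolding ab cd .
    qed
  qed
  finally show ?thesis .
qed

text \<open>The involution \<open>g\<close> exchanges the elements satisfying \<open>P\<close> with
  those that do not.\<close>

lemma card_eq_twice_card_half:
  assumes "finite S" and "\<And>x. x \<in> S \<Longrightarrow> g x \<in> S" and "\<And>x. x \<in> S \<Longrightarrow> g (g x) = x"
    and "\<And>x. x \<in> S \<Longrightarrow> P (g x) \<longleftrightarrow> \<not> P x"
  shows "card S = 2 * card {x \<in> S. P x}"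
proof -
  have "bij_betw g {x \<in> S. P x} {x \<in> S. \<not> P x}"
    using assms by (intro bij_betw_byWitness[where f' = g]) auto
  then have "card {x \<in> S. \<not> P x} = card {x \<in> S. P x}"
    by (simp add: bij_betw_same_card)
  moreover have "card S = card ({x \<in> S. P x} \<union> {x \<in> S. \<not> P x})"
    by (rule arg_cong[where f = card]) auto
  moreover have "\<dots> = card {x \<in> S. P x} + card {x \<in> S. \<not> P x}"
    using assms(1) by (intro card_Un_disjoint) auto
  ultimately show ?thesis by simp
qed

lemma odd_power2_mod_8: "x\<^sup>2 mod 8 = 1" if x: "odd x" for x :: int
proof -
  obtain a where "x = 2 * a + 1" using x by (blast elim: oddE)
  then have "x = 2 * (a + 1) - 1" by simp
  then show ?thesis using power2_odd_triangular[of "a + 1"] by simp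
qed

lemma power2_mod_4: "x\<^sup>2 mod 4 = x mod 2" for x :: int
proof (cases "even x")
  case True
  then show ?thesis by (auto elim!: evenE simp: power2_eq_square)
next
  case False
  then show ?thesis using odd_power2_mod_8[OF False] by presburger
qed

text \<open>For odd \<open>x\<close> and \<open>y\<close> exactly one of \<open>x - y\<close> and
  \<open>x + y\<close> is divisible by 4, so changing the sign of \<open>y\<close> halves the count.
  On the chosen half, \<open>x\<^sup>2 + y\<^sup>2 = 2 * u\<^sup>2 + 2 * b\<^sup>2\<close> with
  \<open>b\<close> even.\<close>

lemma card_odd_reps: "card (odd_reps k) = 2 * card (diag_reps k)"
proof -
  let ?P = "\<lambda>(x, y, z, w). 4 dvd x - (y :: int)"
  have "card (odd_reps k) = 2 * card {p \<in> odd_reps k. ?P p}"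
  proof (rule card_eq_twice_card_half[where g = "\<lambda>(x, y, z, w). (x, - y, z, w)"])
    show "finite (odd_reps k)"
      by (rule finite_subset[OF _ finite_reps[of k]]) (auto simp: odd_reps_def)
    fix p assume "p \<in> odd_reps k"
    then obtain x y z w where p: "p = (x, y, z, w)" "odd x" "odd y" by (auto simp: odd_reps_def)
    have "4 dvd x + y \<longleftrightarrow> \<not> 4 dvd x - y" using p(2,3) by presburger
    then show "?P (case p of (x, y, z, w) \<Rightarrow> (x, - y, z, w)) \<longleftrightarrow> \<not> ?P p" by (simp add: p)
  qed (auto simp: odd_reps_def reps_def)
  also
  let ?f = "\<lambda>(u, b, z, c). (u + b, u - b, z, c :: int)"
  let ?g = "\<lambda>(x, y, z, w). ((x + y) div 2, (x - y) div 2, z, w :: int)"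
  have "card {p \<in> odd_reps k. ?P p} = card (diag_reps k)"
  proof (rule bij_betw_same_card[symmetric], rule bij_betw_byWitness[where f = ?f and f' = ?g])
    show "\<forall>p \<in> diag_reps k. ?g (?f p) = p" by auto
    show "\<forall>p \<in> {p \<in> odd_reps k. ?P p}. ?f (?g p) = p"
      by (auto simp: odd_reps_def)
    show "?f ` diag_reps k \<subseteq> {p \<in> odd_reps k. ?P p}"
      by (auto simp: odd_reps_def reps_def diag_reps_def power2_eq_square algebra_simps)
    show "?g ` {p \<in> odd_reps k. ?P p} \<subseteq> diag_reps k"
    proof clarify
      fix x y z w assume p: "(x, y, z, w) \<in> odd_reps k" "4 dvd x - y"
      then obtain b where b: "x = y + 4 * b" by (metis add.commute diff_add_cancel dvdE)
      have "(x + y) div 2 = y + 2 * b" "(x - y) div 2 = 2 * b" using b by auto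
      then show "((x + y) div 2, (x - y) div 2, z, w) \<in> diag_reps k"
        using p(1) b by (auto simp: odd_reps_def reps_def diag_reps_def power2_eq_square algebra_simps)
    qed
  qed
  finally show ?thesis .
qed

text \<open>The factor 4 comes from two involutions: changing the sign of \<open>y\<close> makes
  \<open>u = (x + y) / 4\<close> integral, and swapping \<open>x\<close> and \<open>y\<close>
  changes the sign of \<open>v = (x - y) / 2\<close>.\<close>

lemma card_mixed_reps:
  assumes "k mod 8 = 1"
  shows "card (mixed_reps (4 * k)) = 4 * card (diag_reps k)"
proof -
  let ?M = "mixed_reps (4 * k)"
  let ?P = "\<lambda>(x, y, z, w). 4 dvd x + (y :: int)"
  \<comment> \<open>This says that \<open>v - w\<close> is divisible by 4, where
    \<open>v = (x - y) / 2\<close>; solving \<open>v = b + 3 * c\<close>, \<open>w = b - c\<close>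
    gives \<open>c = (v - w) / 4\<close> and \<open>b = w + c\<close>.\<close>
  let ?Q = "\<lambda>(x, y, z, w). 8 dvd x - y - 2 * (w :: int)"
  have fin: "finite ?M"
    by (rule finite_subset[OF _ finite_reps[of "4 * k"]]) (auto simp: mixed_reps_def)
  have "card ?M = 2 * card {p \<in> ?M. ?P p}"
  proof (rule card_eq_twice_card_half[where g = "\<lambda>(x, y, z, w). (x, - y, z, w)"])
    fix p assume "p \<in> ?M"
    then obtain x y z w where p: "p = (x, y, z, w)" "odd x" "odd y" by (auto simp: mixed_reps_def)
    have "4 dvd x - y \<longleftrightarrow> \<not> 4 dvd x + y" using p(2,3) by presburger
    then show "?P (case p of (x, y, z, w) \<Rightarrow> (x, - y, z, w)) \<longleftrightarrow> \<not> ?P p" by (simp add: p)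
  qed (use fin in \<open>auto simp: mixed_reps_def reps_def\<close>)
  also have "card {p \<in> ?M. ?P p} = 2 * card {p \<in> {p \<in> ?M. ?P p}. ?Q p}"
  proof (rule card_eq_twice_card_half[where g = "\<lambda>(x, y, z, w). (y, x, z, w)"])
    fix p assume "p \<in> {p \<in> ?M. ?P p}"
    then obtain x y z w where p: "p = (x, y, z, w)" "odd x" "odd w" "4 dvd x + y"
      by (auto simp: mixed_reps_def)
    obtain a where "x + y = 4 * a" using p(4) by (rule dvdE)
    then have y: "y = 4 * a - x" by simp
    \<comment> \<open>Both \<open>v = x - 2 * a\<close> and \<open>w\<close> are odd, so 4 divides
      exactly one of \<open>v - w\<close> and \<open>v + w\<close>.\<close>
    have "8 dvd y - x - 2 * w \<longleftrightarrow> \<not> 8 dvd x - y - 2 * w"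
      using p(2,3) unfolding y by presburger
    then show "?Q (case p of (x, y, z, w) \<Rightarrow> (y, x, z, w)) \<longleftrightarrow> \<not> ?Q p" by (simp add: p)
  qed (use fin in \<open>auto simp: mixed_reps_def reps_def add.commute\<close>)
  also
  let ?f = "\<lambda>(u, b, z, c). (2 * u + b + 3 * c, 2 * u - b - 3 * c, 2 * z :: int, b - c :: int)"
  let ?g = "\<lambda>(x, y, z, w). ((x + y) div 4, w + (x - y - 2 * w) div 8, z div 2 :: int,
    (x - y - 2 * w) div 8 :: int)"
  have "card {p \<in> {p \<in> ?M. ?P p}. ?Q p} = card (diag_reps k)"
  proof (rule bij_betw_same_card[symmetric], rule bij_betw_byWitness[where f = ?f and f' = ?g])
    \<comment> \<open>Surjectivity of \<open>?f\<close> onto the selected quarter: the right-inverse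
      law follows from \<open>gf\<close>, and membership can be checked in the new
      coordinates.\<close>
    have *: "\<exists>q. p = ?f q" if p: "p \<in> {p \<in> {p \<in> ?M. ?P p}. ?Q p}" for p
    proof -
      obtain x y z w where p_eq: "p = (x, y, z, w)" by (cases p)
      with p have "even z" "4 dvd x + y" "8 dvd x - y - 2 * w" by (auto simp: mixed_reps_def)
      then obtain u z' c where "z = 2 * z'" "x + y = 4 * u" "x - y - 2 * w = 8 * c"
        by (metis dvdE)
      then have "p = ?f (u, w + c, z', c)" by (auto simp: p_eq)
      then show ?thesis by blast
    qed
    have gf: "?g (?f q) = q" for q by (cases q) auto
    then show "\<forall>p \<in> diag_reps k. ?g (?f p) = p" by blast
    show "\<forall>p \<in> {p \<in> {p \<in> ?M. ?P p}. ?Q p}. ?f (?g p) = p"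
    proof
      fix p assume "p \<in> {p \<in> {p \<in> ?M. ?P p}. ?Q p}"
      from *[OF this] obtain q where q: "p = ?f q" ..
      show "?f (?g p) = p" unfolding q gf ..
    qed
    show "?f ` diag_reps k \<subseteq> {p \<in> {p \<in> ?M. ?P p}. ?Q p}"
      by (auto simp: mixed_reps_def reps_def diag_reps_def power2_eq_square algebra_simps)
    show "?g ` {p \<in> {p \<in> ?M. ?P p}. ?Q p} \<subseteq> diag_reps k"
    proof (rule image_subsetI)
      fix p assume p: "p \<in> {p \<in> {p \<in> ?M. ?P p}. ?Q p}"
      from *[OF this] obtain q where "p = ?f q" ..
      moreover obtain u b z' c where "q = (u, b, z', c)" by (cases q)
      ultimately have eq: "p = ?f (u, b, z', c)" by simp
      have k: "2 * u\<^sup>2 + 2 * b\<^sup>2 + z'\<^sup>2 + 6 * c\<^sup>2 = k"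
        using p eq by (auto simp: mixed_reps_def reps_def power2_eq_square algebra_simps)
      have bc: "odd (b - c)" using p eq by (auto simp: mixed_reps_def)
      have "odd (2 * u\<^sup>2 + 2 * b\<^sup>2 + z'\<^sup>2 + 6 * c\<^sup>2)" unfolding k using assms by presburger
      then have z': "odd z'" by simp
      \<comment> \<open>Both \<open>k\<close> and \<open>z'\<^sup>2\<close> are 1 modulo 8, so 4
        divides \<open>u\<^sup>2 + b\<^sup>2 + 3 * c\<^sup>2\<close>. One of \<open>b\<close>,
        \<open>c\<close> is odd; if it were \<open>b\<close>, then \<open>u\<^sup>2 + 1\<close>
        would be 0 modulo 4. So \<open>c\<close> is odd, and then so is \<open>u\<close>.\<close>
      have "odd u \<and> even b \<and> odd c"
      proof -
        have "(u mod 2 + b mod 2 + 3 * (c mod 2)) mod 4 = (u\<^sup>2 + b\<^sup>2 + 3 * c\<^sup>2) mod 4"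
          unfolding power2_mod_4[symmetric] by (intro mod_add_cong mod_mult_cong) simp_all
        also have "2 * (u\<^sup>2 + b\<^sup>2 + 3 * c\<^sup>2) = k - z'\<^sup>2" using k by simp
        then have "(u\<^sup>2 + b\<^sup>2 + 3 * c\<^sup>2) mod 4 = 0"
          using assms odd_power2_mod_8[OF z'] by presburger
        finally show ?thesis
          using bc by (auto simp: mod2_eq_if split: if_splits)
      qed
      with k z' have "(u, b, z', c) \<in> diag_reps k" by (simp add: diag_reps_def)
      then show "?g p \<in> diag_reps k" unfolding eq gf .
    qed
  qed
  finally show ?thesis by simp
qed

lemma card_reps_quadruple:
  "card (reps (4 * k)) = card (reps k) + 3 * card (mixed_reps (4 * k))"
proof -
  define E where "E = {(x, y, z, w) \<in> reps (4 * k). even x \<and> even y \<and> even z \<and> even w}"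
  \<comment> \<open>The form is symmetric in its first three variables, so a transposition moves the
    even one to any of these places; hence the factor 3.\<close>
  define X where "X = (\<lambda>(x, y, z, w). (z, y, x, w)) ` mixed_reps (4 * k)"
  define Y where "Y = (\<lambda>(x, y, z, w). (x, z, y, w)) ` mixed_reps (4 * k)"
  define Z where "Z = mixed_reps (4 * k)"
  have X: "X = {(x, y, z, w) \<in> reps (4 * k). even x \<and> odd y \<and> odd z \<and> odd w}"
    by (force simp: X_def mixed_reps_def reps_def)
  have Y: "Y = {(x, y, z, w) \<in> reps (4 * k). odd x \<and> even y \<and> odd z \<and> odd w}"
    by (force simp: Y_def mixed_reps_def reps_def)
  have Z: "Z = {(x, y, z, w) \<in> reps (4 * k). odd x \<and> odd y \<and> even z \<and> odd w}"
    by (simp add: Z_def mixed_reps_def)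
  \<comment> \<open>Modulo 4 the number of odd variables among \<open>x\<close>, \<open>y\<close>,
    \<open>z\<close> is 0 if \<open>w\<close> is even and 2 if \<open>w\<close> is odd.\<close>
  have parity: "(even x \<and> even y \<and> even z \<and> even w) \<or> (even x \<and> odd y \<and> odd z \<and> odd w) \<or>
      (odd x \<and> even y \<and> odd z \<and> odd w) \<or> (odd x \<and> odd y \<and> even z \<and> odd w)"
    if "x\<^sup>2 + y\<^sup>2 + z\<^sup>2 + 6 * w\<^sup>2 = 4 * k" for x y z w :: int
  proof -
    have "(x mod 2 + y mod 2 + z mod 2 + 6 * (w mod 2)) mod 4 =
        (x\<^sup>2 + y\<^sup>2 + z\<^sup>2 + 6 * w\<^sup>2) mod 4"
      unfolding power2_mod_4[symmetric] by (intro mod_add_cong mod_mult_cong) simp_all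
    also have "\<dots> = 0" by (simp add: that)
    finally have "(x mod 2 + y mod 2 + z mod 2 + 6 * (w mod 2)) mod 4 = 0" .
    then show ?thesis
      by (auto simp: mod2_eq_if split: if_splits)
  qed
  have split: "reps (4 * k) = E \<union> (X \<union> (Y \<union> Z))"
    unfolding E_def X Y Z using parity by (auto simp: reps_def)
  have fin: "finite E" "finite X" "finite Y" "finite Z"
    using finite_reps[of "4 * k"] split by auto
  have "card (reps (4 * k)) = card E + (card X + (card Y + card Z))"
    unfolding split
    by (subst card_Un_disjoint; (use fin in \<open>auto simp: E_def X Y Z\<close>)?)+
  moreover have "card X = card Z" "card Y = card Z"
    unfolding X_def Y_def Z_def by (intro card_image; auto simp: inj_on_def)+
  moreover
  let ?f = "\<lambda>(x, y, z, w). (2 * x, 2 * y, 2 * z, 2 * w :: int)"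
  let ?g = "\<lambda>(x, y, z, w). (x div 2, y div 2, z div 2, w div 2 :: int)"
  have "card E = card (reps k)"
  proof (rule bij_betw_same_card[symmetric], rule bij_betw_byWitness[where f = ?f and f' = ?g])
    show "\<forall>p \<in> reps k. ?g (?f p) = p" "\<forall>p \<in> E. ?f (?g p) = p"
      by (auto simp: E_def)
    show "?f ` reps k \<subseteq> E" by (auto simp: E_def reps_def power2_eq_square)
    show "?g ` E \<subseteq> reps k" by (auto simp: E_def reps_def power2_eq_square elim!: evenE)
  qed
  ultimately show ?thesis by (simp add: Z_def)
qed

theorem theorem5p15:
  fixes n :: nat
  assumes "n > 0"
  shows "real (t [1, 1, 1, 6] n) =
    1 / 6 * (real (N [1, 1, 1, 6] (32 * n + 36)) - real (N [1, 1, 1, 6] (8 * n + 9)))"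
proof -
  let ?k = "8 * int n + 9"
  have "?k mod 8 = 1" by presburger
  \<comment> \<open>Here 3 positions times 4, divided by the 2 of \<open>card_odd_reps\<close>, give
    6.\<close>
  then have "card (reps (4 * ?k)) = card (reps ?k) + 6 * card (odd_reps ?k)"
    using card_reps_quadruple[of ?k] card_mixed_reps[of ?k] card_odd_reps[of ?k] by linarith
  then show ?thesis
    unfolding N_eq_card_reps t_eq_card_odd_reps by simp
qed

end
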